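(* Let $\bar x\in\Omega$ (so that $T^F_\Omega(\bar x)<\infty$). Then $$\partial^\infty T^F_\Omega(\bar x)\subset N(\bar x;\Omega)\cap F^*_+.$$ Moreover, this inclusion holds as an equality when $0\in F$ and the support function $\sigma_F$ is sequentially weak$^*$ continuous on the set $-[N(\bar x;\Omega)\cap F^*_+]$.
   Context: $X$ is an arbitrary (real) Banach space with topological dual $X^*$ and pairing $\langle\cdot,\cdot\rangle$; $\xrightarrow{w^*}$ denotes weak$^*$ convergence of sequences in $X^*$. Standing assumptions: $\Omega\subset X$ is nonempty and closed; $F\subset X$ is nonempty, closed, bounded and convex (it is not assumed that $0\in\mathrm{int}\,F$). The minimal time function is $T^F_\Omega(x):=\inf\{t\ge 0\mid \Omega\cap(x+tF)\ne\emptyset\}\in[0,\infty]$, with $\inf\emptyset=\infty$. The support function of $F$ is $\sigma_F(x^* ):=\sup_{x\in F}\langle x^*,x\rangle$, and the positive dual cone of $F$ is $F^*_+:=\{x^*\in X^*\mid\langle x^*,v\rangle\ge0\text{ for all }v\in F\}$. For $\varepsilon\ge0$ and $\Theta\subset X$, the set of $\varepsilon$-normals at $x\in\Theta$ is $\widehat N_\varepsilon(x;\Theta):=\{x^*\in X^*\mid \limsup_{u\to x,\,u\in\Theta}\frac{\langle x^*,u-x\rangle}{\|u-x\|}\le\varepsilon\}$, and $\widehat N_\varepsilon(x;\Theta):=\emptyset$ if $x\notin\Theta$. The basic (limiting) normal cone $N(\bar x;\Theta)$ is the set of $x^*\in X^*$ for which there are sequences $\varepsilon_k\downarrow0$, $x_k\to\bar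 x$, $x_k^*\xrightarrow{w^*}x^*$ with $x_k^*\in\widehat N_{\varepsilon_k}(x_k;\Theta)$ for all $k$. For $\varphi:X\to(-\infty,\infty]$ and $x$ with $\varphi(x)<\infty$, $\widehat\partial_\varepsilon\varphi(x):=\{x^*\in X^*\mid\liminf_{u\to x}\frac{\varphi(u)-\varphi(x)-\langle x^*,u-x\rangle}{\|u-x\|}\ge-\varepsilon\}$. The singular subdifferential $\partial^\infty\varphi(\bar x)$ (for $\varphi(\bar x)<\infty$) is the set of $x^*$ for which there are sequences $\varepsilon_k\downarrow0$, $\lambda_k\downarrow0$ ($\lambda_k>0$), $x_k\to\bar x$ with $\varphi(x_k)\to\varphi(\bar x)$, and $x_k^*\in\widehat\partial_{\varepsilon_k}\varphi(x_k)$ with $\lambda_kx_k^*\xrightarrow{w^*}x^*$. A function $\psi:X^*\to(-\infty,\infty]$ is sequentially weak$^*$ continuous on $S\subset X^*$ if for every $x^*\in S$ and every sequence $x_k^*\xrightarrow{w^*}x^*$ in $X^*$ one has $\psi(x_k^* )\to\psi(x^* )$. *)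

theory Defs
  imports "HOL-Analysis.Analysis"
begin

text \<open>
  The dual space of \<open>'a\<close> is the type \<open>'a \<Rightarrow>\<^sub>L real\<close>.  For functionals, the strong operator
  topology of the library (pointwise convergence) is the weak-star topology.
\<close>

definition weak_star_tendsto ::
    "(nat \<Rightarrow> ('a::real_normed_vector \<Rightarrow>\<^sub>L real)) \<Rightarrow> ('a \<Rightarrow>\<^sub>L real) \<Rightarrow> bool" where
  "weak_star_tendsto f l \<longleftrightarrow> limitin strong_operator_topology f l sequentially"

lemma weak_star_tendsto_iff:
  "weak_star_tendsto f l \<longleftrightarrow>
    (\<forall>v. (\<lambda>k. blinfun_apply (f k) v) \<longlonglongrightarrow> blinfun_apply l v)"
proof
  assume *: "weak_star_tendsto f l"
  show "\<forall>v. (\<lambda>k. blinfun_apply (f k) v) \<longlonglongrightarrow> blinfun_apply l v"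
  proof
    fix v
    show "(\<lambda>k. blinfun_apply (f k) v) \<longlonglongrightarrow> blinfun_apply l v"
      using continuous_map_limit[OF strong_operator_topology_continuous_evaluation
          *[unfolded weak_star_tendsto_def], of v]
      by (simp add: o_def)
  qed
next
  assume *: "\<forall>v. (\<lambda>k. blinfun_apply (f k) v) \<longlonglongrightarrow> blinfun_apply l v"
  then have "limitin (product_topology (\<lambda>v. euclidean) UNIV)
      (\<lambda>k. blinfun_apply (f k)) (blinfun_apply l) sequentially"
    by (simp add: limitin_componentwise)
  then have "limitin euclidean (\<lambda>k. blinfun_apply (f k)) (blinfun_apply l) sequentially"
    by (simp add: euclidean_product_topology)
  then show "weak_star_tendsto f l"
    unfolding weak_star_tendsto_def limitin_def strong_operator_topology_def
      openin_pullback_topology topspace_pullback_topology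
    by auto
qed

definition minimal_time :: "'a::real_normed_vector set \<Rightarrow> 'a set \<Rightarrow> 'a \<Rightarrow> ereal" where
  "minimal_time F \<Omega> x =
    Inf {ereal t | t. t \<ge> 0 \<and> \<Omega> \<inter> (\<lambda>v. x + t *\<^sub>R v) ` F \<noteq> {}}"

definition support_function ::
    "'a::real_normed_vector set \<Rightarrow> ('a \<Rightarrow>\<^sub>L real) \<Rightarrow> ereal" where
  "support_function F xs = (SUP v\<in>F. ereal (blinfun_apply xs v))"

definition positive_dual_cone ::
    "'a::real_normed_vector set \<Rightarrow> ('a \<Rightarrow>\<^sub>L real) set" where
  "positive_dual_cone F = {xs. \<forall>v\<in>F. blinfun_apply xs v \<ge> 0}"

text \<open>
  The upper limit over \<open>at x within \<Theta>\<close> excludes \<open>u = x\<close>; at an isolated point of \<open>\<Theta>\<close> it is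
  \<open>- \<infinity>\<close>, so that every functional is a normal there.
\<close>

definition eps_normals ::
    "real \<Rightarrow> 'a::real_normed_vector set \<Rightarrow> 'a \<Rightarrow> ('a \<Rightarrow>\<^sub>L real) set" where
  "eps_normals \<epsilon> \<Theta> x =
    (if x \<in> \<Theta> then
       {xs. Limsup (at x within \<Theta>)
              (\<lambda>u. ereal (blinfun_apply xs (u - x) / norm (u - x))) \<le> ereal \<epsilon>}
     else {})"

text \<open>
  Here and in \<open>singular_subdifferential\<close>, \<open>\<epsilon>\<^sub>k \<down> 0\<close> means \<open>\<epsilon>\<^sub>k \<longrightarrow> 0\<close> with
  \<open>\<epsilon>\<^sub>k \<ge> 0\<close>.  Monotonicity or strict positivity could be imposed without changing the sets,
  since \<open>eps_normals\<close> and \<open>eps_subdifferential\<close> increase with \<open>\<epsilon>\<close>.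
\<close>

definition limiting_normal_cone ::
    "'a::real_normed_vector set \<Rightarrow> 'a \<Rightarrow> ('a \<Rightarrow>\<^sub>L real) set" where
  "limiting_normal_cone \<Theta> xbar =
    {xs. \<exists>(\<epsilon> :: nat \<Rightarrow> real) (x :: nat \<Rightarrow> 'a) (x' :: nat \<Rightarrow> ('a \<Rightarrow>\<^sub>L real)).
       (\<forall>k. \<epsilon> k \<ge> 0) \<and> \<epsilon> \<longlonglongrightarrow> 0 \<and>
       x \<longlonglongrightarrow> xbar \<and>
       weak_star_tendsto x' xs \<and>
       (\<forall>k. x' k \<in> eps_normals (\<epsilon> k) \<Theta> (x k))}"

text \<open>The subdifferentials are meant for functions that never take the value \<open>- \<infinity>\<close>.\<close>

definition eps_subdifferential ::
    "real \<Rightarrow> ('a::real_normed_vector \<Rightarrow> ereal) \<Rightarrow> 'a \<Rightarrow> ('a \<Rightarrow>\<^sub>L real) set" where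
  "eps_subdifferential \<epsilon> \<phi> x =
    (if \<phi> x < \<infinity> then
       {xs. Liminf (at x)
              (\<lambda>u. (\<phi> u - \<phi> x - ereal (blinfun_apply xs (u - x))) / ereal (norm (u - x)))
            \<ge> - ereal \<epsilon>}
     else {})"

definition singular_subdifferential ::
    "('a::real_normed_vector \<Rightarrow> ereal) \<Rightarrow> 'a \<Rightarrow> ('a \<Rightarrow>\<^sub>L real) set" where
  "singular_subdifferential \<phi> xbar =
    (if \<phi> xbar < \<infinity> then
       {xs. \<exists>(\<epsilon> :: nat \<Rightarrow> real) (lam :: nat \<Rightarrow> real) (x :: nat \<Rightarrow> 'a)
              (x' :: nat \<Rightarrow> ('a \<Rightarrow>\<^sub>L real)).
          (\<forall>k. \<epsilon> k \<ge> 0) \<and> \<epsilon> \<longlonglongrightarrow> 0 \<and>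
          (\<forall>k. lam k > 0) \<and> lam \<longlonglongrightarrow> 0 \<and>
          x \<longlonglongrightarrow> xbar \<and> (\<lambda>k. \<phi> (x k)) \<longlonglongrightarrow> \<phi> xbar \<and>
          (\<forall>k. x' k \<in> eps_subdifferential (\<epsilon> k) \<phi> (x k)) \<and>
          weak_star_tendsto (\<lambda>k. lam k *\<^sub>R x' k) xs}
     else {})"

text \<open>
  The approximating sequence ranges over the whole dual space, not only over \<open>S\<close>.
\<close>

definition seq_weak_star_continuous_on ::
    "('a::real_normed_vector \<Rightarrow>\<^sub>L real) set \<Rightarrow> (('a \<Rightarrow>\<^sub>L real) \<Rightarrow> ereal) \<Rightarrow> bool" where
  "seq_weak_star_continuous_on S \<psi> \<longleftrightarrow>
    (\<forall>xs\<in>S. \<forall>x'. weak_star_tendsto x' xs \<longrightarrow> (\<lambda>k. \<psi> (x' k)) \<longlonglongrightarrow> \<psi> xs)"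

end

theory Submission
  imports Defs
begin

text \<open>
  Write \<open>T\<close> for the minimal time function and \<open>\<sigma>\<^sub>F\<close> for the support function.  Everything rests on
  two comparisons between \<open>\<epsilon>\<close>-subgradients of \<open>T\<close> and \<open>\<epsilon>\<close>-normals to \<open>\<Omega>\<close>, which relate a point
  \<open>u\<close> to the targets \<open>u + t *\<^sub>R v \<in> \<Omega>\<close>, \<open>v \<in> F\<close>, over whose times \<open>t\<close> the infimum \<open>T u\<close> is taken.

  From subgradients to normals: moving a point \<open>x\<close> and an almost optimal target \<open>x + s *\<^sub>R v\<close> in
  parallel shows that an \<open>\<epsilon>\<close>-subgradient of \<open>T\<close> at \<open>x\<close> is almost an \<open>\<epsilon>\<close>-normal at that target.
  Ekeland's principle turns this into an actual \<open>\<epsilon>'\<close>-normal at a nearby point of \<open>\<Omega>\<close>, with \<open>\<epsilon>'\<close>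
  close to \<open>\<epsilon>\<close> (\<open>minimal_time_subgradient_eps_normal\<close>).  Moreover \<open>T\<close> grows at most at unit rate in
  the directions of \<open>- F\<close>, so subgradients are bounded below by about \<open>-1\<close> on \<open>F\<close>
  (\<open>minimal_time_subgradient_lower_bound\<close>).  After multiplication by \<open>\<lambda>\<^sub>k \<down> 0\<close> this bound becomes
  nonnegativity on \<open>F\<close>, and the base points converge because \<open>T (x\<^sub>k) \<rightarrow> T xbar = 0\<close> and \<open>F\<close> is bounded.

  From normals to subgradients: an \<open>\<epsilon>\<close>-normal \<open>y\<close> at a point of \<open>\<Omega>\<close> is an \<open>\<epsilon>\<close>-subgradient of \<open>T\<close>
  there as soon as \<open>\<sigma>\<^sub>F (- y)\<close> is less than \<open>1\<close> with some room for \<open>\<epsilon>\<close>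
  (\<open>eps_normal_minimal_time_subgradient\<close>).  Normals \<open>x\<^sub>k'\<close> that approximate an element of the cone have
  \<open>\<sigma>\<^sub>F (- x\<^sub>k') \<rightarrow> 0\<close> by the continuity hypothesis.  They therefore remain admissible after division by
  a suitably slow \<open>\<lambda>\<^sub>k \<down> 0\<close>, which exhibits their limit as a singular subgradient.
\<close>

section \<open>Ekeland's variational principle\<close>

text \<open>
  Order the points of \<open>S\<close> by \<open>y \<preceq> x \<longleftrightarrow> f y + c * dist x y \<le> f x\<close>.  Descending from \<open>x0\<close> and
  choosing at each step a point whose value is almost least among those below the current one
  makes the diameters of the sets of points below shrink to \<open>0\<close>, so the limit has nothing below it.
\<close>

lemma ekeland_variational_principle:
  fixes f :: "'a::complete_space \<Rightarrow> real"
  assumes S: "closed S" and x0: "x0 \<in> S" and cont: "continuous_on S f"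
    and bd: "\<And>x. x \<in> S \<Longrightarrow> m \<le> f x" and c: "c > 0"
  obtains z where "z \<in> S" "f z + c * dist x0 z \<le> f x0"
    "\<And>y. y \<in> S \<Longrightarrow> f z \<le> f y + c * dist z y"
proof -
  define B where "B x = {y\<in>S. f y + c * dist x y \<le> f x}" for x
  have B_refl: "x \<in> B x" if "x \<in> S" for x using that by (simp add: B_def)
  have B_trans: "z \<in> B x" if "y \<in> B x" "z \<in> B y" for x y z
  proof -
    have "c * dist x z \<le> c * dist x y + c * dist y z"
      using c dist_triangle[of x z y] by (simp flip: distrib_left)
    then show ?thesis using that by (auto simp: B_def)
  qed
  have step: "\<exists>y\<in>B x. \<forall>w\<in>B x. f y \<le> f w + (1/2)^n" if xS: "x \<in> S" for x and n :: nat
  proof -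
    have bb: "bdd_below (f ` B x)" using bd by (auto simp: B_def intro!: bdd_belowI[of _ m])
    have "Inf (f ` B x) < Inf (f ` B x) + (1/2)^n" by simp
    then obtain y where y: "y \<in> B x" "f y < Inf (f ` B x) + (1/2)^n"
      using B_refl[OF xS] bb by (subst (asm) cInf_less_iff) auto
    have "f y \<le> f w + (1/2)^n" if "w \<in> B x" for w
      using cInf_lower[OF imageI[OF that] bb] y by simp
    then show ?thesis using y by blast
  qed
  have "\<exists>s. \<forall>n. (s n \<in> S \<and> (n = 0 \<longrightarrow> s n = x0)) \<and>
      (s (Suc n) \<in> B (s n) \<and> (\<forall>w\<in>B (s n). f (s (Suc n)) \<le> f w + (1/2)^n))"
  proof (rule dependent_nat_choice)
    fix x and n :: nat assume "x \<in> S \<and> (n = 0 \<longrightarrow> x = x0)"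
    then show "\<exists>y. (y \<in> S \<and> (Suc n = 0 \<longrightarrow> y = x0)) \<and>
        (y \<in> B x \<and> (\<forall>w\<in>B x. f y \<le> f w + (1/2)^n))"
      using step[of x n] by (auto simp: B_def)
  qed (use x0 in auto)
  then obtain s where s0: "s 0 = x0" and sS: "\<And>n. s n \<in> S"
    and sB: "\<And>n. s (Suc n) \<in> B (s n) \<and> (\<forall>w\<in>B (s n). f (s (Suc n)) \<le> f w + (1/2)^n)"
    by blast
  have desc: "s (n + k) \<in> B (s n)" for n k
    by (induction k) (use B_refl sS B_trans sB in auto)
  have small: "dist (s (Suc n)) y \<le> (1/2)^n / c" if "y \<in> B (s (Suc n))" for n y
  proof -
    have "f (s (Suc n)) \<le> f y + (1/2)^n" using B_trans sB that by blast
    then have "c * dist (s (Suc n)) y \<le> (1/2)^n" using that by (simp add: B_def)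
    then show ?thesis using c by (simp add: pos_le_divide_eq mult.commute)
  qed
  have lim0: "(\<lambda>n. (1/2)^n / c) \<longlonglongrightarrow> 0"
    using tendsto_divide[OF LIMSEQ_power_zero[of "1/2::real"] tendsto_const, of c] c by simp
  have "Cauchy s"
  proof (rule metric_CauchyI)
    fix e :: real assume e: "e > 0"
    obtain N where N: "(1/2)^N / c < e / 2"
      using order_tendstoD(2)[OF lim0, of "e/2"] e by (auto simp: eventually_sequentially)
    have "dist (s m) (s n) < e" if "m \<ge> Suc N" "n \<ge> Suc N" for m n
    proof -
      have "dist (s (Suc N)) (s m) \<le> (1/2)^N / c" "dist (s (Suc N)) (s n) \<le> (1/2)^N / c"
        using small desc[of "Suc N" "m - Suc N"] desc[of "Suc N" "n - Suc N"] that by simp_all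
      then show ?thesis using dist_triangle3[of "s m" "s n" "s (Suc N)"] N by linarith
    qed
    then show "\<exists>M. \<forall>m\<ge>M. \<forall>n\<ge>M. dist (s m) (s n) < e" by blast
  qed
  then obtain z where z: "s \<longlonglongrightarrow> z" using Cauchy_convergent convergent_def by blast
  have zS: "z \<in> S" using closed_sequentially[OF S _ z] sS by blast
  have fz: "(\<lambda>n. f (s n)) \<longlonglongrightarrow> f z"
    using continuous_on_tendsto_compose[OF cont z zS] sS by simp
  have zB: "z \<in> B (s n)" for n
  proof -
    have "(\<lambda>k. f (s (k + n)) + c * dist (s n) (s (k + n))) \<longlonglongrightarrow> f z + c * dist (s n) z"
      using LIMSEQ_ignore_initial_segment[OF fz, of n] LIMSEQ_ignore_initial_segment[OF z, of n]
      by (intro tendsto_intros)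
    moreover have "f (s (k + n)) + c * dist (s n) (s (k + n)) \<le> f (s n)" for k
      using desc[of n k] by (simp add: B_def add.commute)
    ultimately have "f z + c * dist (s n) z \<le> f (s n)" by (intro LIMSEQ_le_const2) blast+
    then show ?thesis using zS by (simp add: B_def)
  qed
  have min: "f z \<le> f y + c * dist z y" if "y \<in> S" for y
  proof (rule ccontr)
    assume *: "\<not> ?thesis"
    then have "y \<in> B z" using that by (simp add: B_def)
    then have "dist (s (Suc n)) y \<le> (1/2)^n / c" for n using small B_trans zB by blast
    then have "(\<lambda>n. dist (s (Suc n)) y) \<longlonglongrightarrow> 0"
      by (intro tendsto_sandwich[OF _ _ tendsto_const lim0]) auto
    then have "(\<lambda>n. s (Suc n)) \<longlonglongrightarrow> y" by (simp add: tendsto_dist_iff[symmetric])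
    then have "y = z" using z LIMSEQ_Suc LIMSEQ_unique by blast
    then show False using * by simp
  qed
  show ?thesis using that[OF zS _ min] zB[of 0] s0 by (simp add: B_def)
qed

section \<open>Normals and subgradients as local inequalities\<close>

lemma eps_normals_iff:
  "xs \<in> eps_normals \<epsilon> \<Theta> x \<longleftrightarrow> x \<in> \<Theta> \<and>
    (\<forall>\<eta>>0. \<exists>\<delta>>0. \<forall>u\<in>\<Theta>. dist u x < \<delta> \<longrightarrow>
       blinfun_apply xs (u - x) \<le> (\<epsilon> + \<eta>) * norm (u - x))" (is "_ \<longleftrightarrow> _ \<and> ?R")
proof -
  let ?q = "\<lambda>u. blinfun_apply xs (u - x) / norm (u - x)"
  have "Limsup (at x within \<Theta>) (\<lambda>u. ereal (?q u)) \<le> ereal \<epsilon> \<longleftrightarrow> ?R"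
  proof
    assume L: "Limsup (at x within \<Theta>) (\<lambda>u. ereal (?q u)) \<le> ereal \<epsilon>"
    show ?R
    proof (intro allI impI)
      fix \<eta> :: real assume "\<eta> > 0"
      then have "eventually (\<lambda>u. ereal (?q u) < ereal (\<epsilon> + \<eta>)) (at x within \<Theta>)"
        using L[unfolded Limsup_le_iff, rule_format, of "ereal (\<epsilon> + \<eta>)"] by simp
      then obtain \<delta> where "\<delta> > 0"
        and d: "\<And>u. u \<in> \<Theta> \<Longrightarrow> u \<noteq> x \<Longrightarrow> dist u x < \<delta> \<Longrightarrow> ?q u < \<epsilon> + \<eta>"
        by (auto simp: eventually_at)
      have "blinfun_apply xs (u - x) \<le> (\<epsilon> + \<eta>) * norm (u - x)" if "u \<in> \<Theta>" "dist u x < \<delta>" for u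
        using d[OF that(1) _ that(2)] by (cases "u = x") (auto simp: divide_simps)
      with \<open>\<delta> > 0\<close> show "\<exists>\<delta>>0. \<forall>u\<in>\<Theta>. dist u x < \<delta> \<longrightarrow>
          blinfun_apply xs (u - x) \<le> (\<epsilon> + \<eta>) * norm (u - x)" by blast
    qed
  next
    assume R: ?R
    show "Limsup (at x within \<Theta>) (\<lambda>u. ereal (?q u)) \<le> ereal \<epsilon>"
      unfolding Limsup_le_iff
    proof (intro allI impI)
      fix y assume "ereal \<epsilon> < y"
      then obtain r where r: "\<epsilon> < r" "ereal r < y" using ereal_dense2[of "ereal \<epsilon>" y] by auto
      then obtain \<delta> where "\<delta> > 0"
        and d: "\<And>u. u \<in> \<Theta> \<Longrightarrow> dist u x < \<delta> \<Longrightarrow> blinfun_apply xs (u - x) \<le> r * norm (u - x)"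
        using R[rule_format, of "r - \<epsilon>"] by auto
      have "ereal (?q u) < y" if "u \<in> \<Theta>" "u \<noteq> x" "dist u x < \<delta>" for u
      proof -
        have "?q u \<le> r" using d[OF that(1,3)] that(2) by (simp add: divide_simps)
        then show ?thesis using r(2) by (meson ereal_less_eq(3) le_less_trans)
      qed
      with \<open>\<delta> > 0\<close> show "\<forall>\<^sub>F u in at x within \<Theta>. ereal (?q u) < y"
        unfolding eventually_at by blast
    qed
  qed
  then show ?thesis by (simp add: eps_normals_def)
qed

lemma eps_subdifferential_iff:
  assumes r: "\<phi> x = ereal r" and fin: "\<And>u. \<phi> u \<noteq> -\<infinity>"
  shows "xs \<in> eps_subdifferential \<epsilon> \<phi> x \<longleftrightarrow>
    (\<forall>\<eta>>0. \<exists>\<delta>>0. \<forall>u. dist u x < \<delta> \<longrightarrow>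
       ereal (r + blinfun_apply xs (u - x) - (\<epsilon> + \<eta>) * norm (u - x)) \<le> \<phi> u)"
    (is "_ \<longleftrightarrow> ?R")
proof -
  let ?q = "\<lambda>u. (\<phi> u - \<phi> x - ereal (blinfun_apply xs (u - x))) / ereal (norm (u - x))"
  have qle: "ereal a \<le> ?q u \<longleftrightarrow> ereal (r + blinfun_apply xs (u - x) + a * norm (u - x)) \<le> \<phi> u"
    if "u \<noteq> x" for u a
    using fin[of u] that r by (cases "\<phi> u") (auto simp: field_simps)
  have "- ereal \<epsilon> \<le> Liminf (at x) ?q \<longleftrightarrow> ?R"
  proof
    assume L: "- ereal \<epsilon> \<le> Liminf (at x) ?q"
    show ?R
    proof (intro allI impI)
      fix \<eta> :: real assume "\<eta> > 0"
      then have "eventually (\<lambda>u. ereal (- (\<epsilon> + \<eta>)) < ?q u) (at x)"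
        using L[unfolded le_Liminf_iff, rule_format, of "ereal (- (\<epsilon> + \<eta>))"] by simp
      then obtain \<delta> where "\<delta> > 0"
        and d: "\<And>u. u \<noteq> x \<Longrightarrow> dist u x < \<delta> \<Longrightarrow> ereal (- (\<epsilon> + \<eta>)) \<le> ?q u"
        by (auto simp: eventually_at intro: less_imp_le)
      have "ereal (r + blinfun_apply xs (u - x) - (\<epsilon> + \<eta>) * norm (u - x)) \<le> \<phi> u"
        if "dist u x < \<delta>" for u
      proof (cases "u = x")
        case True then show ?thesis using r by simp
      next
        case False
        from d[OF this that] show ?thesis unfolding qle[OF False] by (simp add: algebra_simps)
      qed
      with \<open>\<delta> > 0\<close> show "\<exists>\<delta>>0. \<forall>u. dist u x < \<delta> \<longrightarrow>
          ereal (r + blinfun_apply xs (u - x) - (\<epsilon> + \<eta>) * norm (u - x)) \<le> \<phi> u" by blast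
    qed
  next
    assume R: ?R
    show "- ereal \<epsilon> \<le> Liminf (at x) ?q"
      unfolding le_Liminf_iff
    proof (intro allI impI)
      fix y assume "y < - ereal \<epsilon>"
      then obtain a where a: "y < ereal a" "a < - \<epsilon>"
        using ereal_dense2[of y "ereal (- \<epsilon>)"] by auto
      then obtain \<delta> where "\<delta> > 0" and d: "\<And>u. dist u x < \<delta> \<Longrightarrow>
          ereal (r + blinfun_apply xs (u - x) + a * norm (u - x)) \<le> \<phi> u"
        using R[rule_format, of "- a - \<epsilon>"] by (auto simp: algebra_simps)
      have "y < ?q u" if "u \<noteq> x" "dist u x < \<delta>" for u
        using d[OF that(2)] unfolding qle[OF that(1), symmetric] using a(1) by (rule less_le_trans[rotated])
      with \<open>\<delta> > 0\<close> show "\<forall>\<^sub>F u in at x. y < ?q u" unfolding eventually_at by blast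
    qed
  qed
  then show ?thesis by (simp add: eps_subdifferential_def r)
qed

lemma eps_normals_scaleR:
  assumes "xs \<in> eps_normals \<epsilon> \<Theta> x" and c: "c > 0"
  shows "c *\<^sub>R xs \<in> eps_normals (c * \<epsilon>) \<Theta> x"
  unfolding eps_normals_iff
proof (intro conjI allI impI)
  show "x \<in> \<Theta>" using assms(1) by (simp add: eps_normals_iff)
  fix \<eta> :: real assume "\<eta> > 0"
  then obtain \<delta> where "\<delta> > 0" and d: "\<And>u. u \<in> \<Theta> \<Longrightarrow> dist u x < \<delta> \<Longrightarrow>
      blinfun_apply xs (u - x) \<le> (\<epsilon> + \<eta> / c) * norm (u - x)"
    using assms by (auto simp: eps_normals_iff dest!: spec[of _ "\<eta> / c"])
  have "blinfun_apply (c *\<^sub>R xs) (u - x) \<le> (c * \<epsilon> + \<eta>) * norm (u - x)"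
    if "u \<in> \<Theta>" "dist u x < \<delta>" for u
    using mult_left_mono[OF d[OF that], of c] c by (simp add: scaleR_blinfun.rep_eq algebra_simps)
  with \<open>\<delta> > 0\<close> show "\<exists>\<delta>>0. \<forall>u\<in>\<Theta>. dist u x < \<delta> \<longrightarrow>
      blinfun_apply (c *\<^sub>R xs) (u - x) \<le> (c * \<epsilon> + \<eta>) * norm (u - x)" by blast
qed

section \<open>The minimal time function\<close>

lemma minimal_time_nonneg: "0 \<le> minimal_time F \<Omega> x"
  unfolding minimal_time_def by (rule Inf_greatest) auto

lemma minimal_time_le:
  assumes "t \<ge> 0" "v \<in> F" "x + t *\<^sub>R v \<in> \<Omega>"
  shows "minimal_time F \<Omega> x \<le> ereal t"
  unfolding minimal_time_def using assms by (intro Inf_lower) auto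

lemma minimal_time_lessE:
  assumes "minimal_time F \<Omega> x < ereal s"
  obtains t v where "t \<ge> 0" "t < s" "v \<in> F" "x + t *\<^sub>R v \<in> \<Omega>"
  using assms unfolding minimal_time_def Inf_less_iff by auto

lemma minimal_time_eq_0:
  assumes "F \<noteq> {}" "x \<in> \<Omega>"
  shows "minimal_time F \<Omega> x = 0"
  using assms minimal_time_le[of 0 _ F x \<Omega>] minimal_time_nonneg[of F \<Omega> x]
  by (auto simp: zero_ereal_def intro: antisym)

lemma minimal_time_subgradientD:
  assumes "xs \<in> eps_subdifferential \<epsilon> (minimal_time F \<Omega>) x" and "\<eta> > 0"
  obtains r \<delta> where "minimal_time F \<Omega> x = ereal r" "r \<ge> 0" "\<delta> > 0"
    "\<And>u. dist u x < \<delta> \<Longrightarrow>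
      ereal (r + blinfun_apply xs (u - x) - (\<epsilon> + \<eta>) * norm (u - x)) \<le> minimal_time F \<Omega> u"
proof -
  have fin: "minimal_time F \<Omega> u \<noteq> -\<infinity>" for u using minimal_time_nonneg[of F \<Omega> u] by auto
  have "minimal_time F \<Omega> x < \<infinity>" using assms(1) by (auto simp: eps_subdifferential_def split: if_splits)
  then obtain r where r: "minimal_time F \<Omega> x = ereal r" using fin[of x] by (cases "minimal_time F \<Omega> x") auto
  moreover have "r \<ge> 0" using minimal_time_nonneg[of F \<Omega> x] r by simp
  ultimately show ?thesis using assms that unfolding eps_subdifferential_iff[of "minimal_time F \<Omega>", OF r fin] by blast
qed

text \<open>
  A vector \<open>v \<in> F\<close> followed backwards for time \<open>s\<close> can be made up for in time \<open>s\<close>: by convexity,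
  the motion with velocity \<open>v\<close> for time \<open>s\<close> and then \<open>w \<in> F\<close> for time \<open>t\<close> is one with a
  single velocity in \<open>F\<close> for time \<open>s + t\<close>.
\<close>

lemma minimal_time_diff_le:
  assumes "convex F" "v \<in> F" "s \<ge> 0"
  shows "minimal_time F \<Omega> (x - s *\<^sub>R v) \<le> minimal_time F \<Omega> x + ereal s"
proof (rule ccontr)
  assume "\<not> ?thesis"
  then have *: "minimal_time F \<Omega> x + ereal s < minimal_time F \<Omega> (x - s *\<^sub>R v)" by simp
  then obtain r where r: "minimal_time F \<Omega> x = ereal r"
    using minimal_time_nonneg[of F \<Omega> x] by (cases "minimal_time F \<Omega> x") auto
  obtain q where q: "ereal (r + s) < ereal q" "ereal q < minimal_time F \<Omega> (x - s *\<^sub>R v)"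
    using ereal_dense2 * r by (metis plus_ereal.simps(1))
  then have "minimal_time F \<Omega> x < ereal (q - s)" using r by simp
  then obtain t w where t: "t \<ge> 0" "t < q - s" "w \<in> F" "x + t *\<^sub>R w \<in> \<Omega>"
    by (rule minimal_time_lessE)
  have "minimal_time F \<Omega> (x - s *\<^sub>R v) \<le> ereal (s + t)"
  proof (cases "s + t = 0")
    case True
    then have "s = 0" "t = 0" using t assms by auto
    then show ?thesis using minimal_time_le[of 0 w F x] t by simp
  next
    case False
    then have pos: "s + t > 0" using t assms by simp
    let ?w = "(s / (s + t)) *\<^sub>R v + (t / (s + t)) *\<^sub>R w"
    have "?w \<in> F"
      using assms t pos by (intro convexD) (auto simp: add_divide_distrib[symmetric])
    moreover have "(s + t) *\<^sub>R ?w = s *\<^sub>R v + t *\<^sub>R w"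
      using pos by (simp add: scaleR_add_right)
    ultimately show ?thesis using t assms
      by (intro minimal_time_le[of _ ?w]) auto
  qed
  also have "\<dots> < ereal q" using t by simp
  finally show False using q by simp
qed

section \<open>Subgradients of the minimal time function are nearly normals\<close>

text \<open>
  If \<open>\<omega>0 = x + s *\<^sub>R v\<close> is a point of \<open>\<Omega>\<close> reached in a time \<open>s\<close> that exceeds the minimal one by less
  than \<open>\<gamma>\<close>, then a point \<open>\<omega> \<in> \<Omega>\<close> is reached from \<open>\<omega> - s *\<^sub>R v\<close> in time \<open>s\<close>, too.  The subgradient
  inequality at \<open>\<omega> - s *\<^sub>R v = x + (\<omega> - \<omega>0)\<close> therefore says that \<open>\<omega>0\<close> maximizes
  \<open>\<omega> \<mapsto> xs (\<omega> - \<omega>0) - (\<epsilon> + \<eta>) * norm (\<omega> - \<omega>0)\<close> up to \<open>\<gamma>\<close> near \<open>\<omega>0\<close> in \<open>\<Omega>\<close>.  The minimal time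
  need not be attained, so Ekeland's principle replaces \<open>\<omega>0\<close> by a nearby maximizer of a perturbed function.
\<close>

lemma minimal_time_subgradient_eps_normal:
  fixes \<Omega> F :: "'a::banach set"
  assumes "closed \<Omega>" and M: "\<And>v. v \<in> F \<Longrightarrow> norm v \<le> M"
    and sub: "xs \<in> eps_subdifferential \<epsilon> (minimal_time F \<Omega>) x" and "\<epsilon> \<ge> 0" and \<eta>: "\<eta> > 0"
  obtains \<omega> where "xs \<in> eps_normals (\<epsilon> + 2 * \<eta>) \<Omega> \<omega>"
    "dist \<omega> x \<le> (real_of_ereal (minimal_time F \<Omega> x) + \<eta>) * M + \<eta>"
proof -
  obtain r \<delta> where r: "minimal_time F \<Omega> x = ereal r" "r \<ge> 0" and "\<delta> > 0"
    and d: "\<And>u. dist u x < \<delta> \<Longrightarrow>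
      ereal (r + blinfun_apply xs (u - x) - (\<epsilon> + \<eta>) * norm (u - x)) \<le> minimal_time F \<Omega> u"
    by (rule minimal_time_subgradientD[OF sub \<eta>]) blast
  \<comment> \<open>A perturbation of slope \<open>\<eta>\<close> moves the point by at most \<open>\<gamma> / \<eta>\<close>.  The bound \<open>\<delta> / 4\<close> keeps a
      neighbourhood of the new point in the ball of radius \<open>\<delta> / 2\<close> on which the principle is applied;
      the bound \<open>\<eta>\<close> is for the final distance estimate.\<close>
  define \<gamma> where "\<gamma> = min \<eta> (\<eta> * min (\<delta> / 4) \<eta>)"
  have \<gamma>: "\<gamma> > 0" "\<gamma> \<le> \<eta>" "\<gamma> / \<eta> \<le> \<delta> / 4" "\<gamma> / \<eta> \<le> \<eta>"
    using \<eta> \<open>\<delta> > 0\<close> by (auto simp: \<gamma>_def min_def divide_simps mult.commute)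
  have "minimal_time F \<Omega> x < ereal (r + \<gamma>)" using r \<gamma> by simp
  then obtain s v where s: "s \<ge> 0" "s < r + \<gamma>" "v \<in> F" "x + s *\<^sub>R v \<in> \<Omega>" by (rule minimal_time_lessE)
  define \<omega>0 where "\<omega>0 = x + s *\<^sub>R v"
  define f where "f \<omega> = (\<epsilon> + \<eta>) * norm (\<omega> - \<omega>0) - blinfun_apply xs (\<omega> - \<omega>0)" for \<omega>
  let ?S = "\<Omega> \<inter> cball \<omega>0 (\<delta> / 2)"
  have low: "- \<gamma> \<le> f \<omega>" if "\<omega> \<in> ?S" for \<omega>
  proof -
    let ?u = "\<omega> - s *\<^sub>R v"
    have ux: "?u - x = \<omega> - \<omega>0" by (simp add: \<omega>0_def)
    have "dist ?u x < \<delta>"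
      using that \<open>\<delta> > 0\<close> unfolding dist_norm ux by (simp add: dist_norm norm_minus_commute)
    then have "ereal (r - f \<omega>) \<le> minimal_time F \<Omega> ?u"
      using d[of ?u] unfolding ux f_def by (simp add: algebra_simps)
    also have "\<dots> \<le> ereal s" using s that by (intro minimal_time_le[of s v]) auto
    finally show ?thesis using s by simp
  qed
  have f0: "f \<omega>0 = 0" by (simp add: f_def)
  obtain \<omega> where \<omega>: "\<omega> \<in> ?S" "f \<omega> + \<eta> * dist \<omega>0 \<omega> \<le> f \<omega>0"
    "\<And>y. y \<in> ?S \<Longrightarrow> f \<omega> \<le> f y + \<eta> * dist \<omega> y"
  proof (rule ekeland_variational_principle[of ?S \<omega>0 f "- \<gamma>" \<eta>])
    show "closed ?S" using assms by auto
    show "\<omega>0 \<in> ?S" using s \<open>\<delta> > 0\<close> by (simp add: \<omega>0_def)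
    show "continuous_on ?S f" unfolding f_def by (intro continuous_intros)
  qed (use low \<eta> in auto)
  have "dist \<omega>0 \<omega> \<le> \<gamma> / \<eta>" using \<omega>(2) f0 low[OF \<omega>(1)] \<eta> by (simp add: field_simps)
  then have near: "dist \<omega>0 \<omega> \<le> \<delta> / 4" "dist \<omega>0 \<omega> \<le> \<eta>" using \<gamma> by linarith+
  have normal: "xs \<in> eps_normals (\<epsilon> + 2 * \<eta>) \<Omega> \<omega>"
    unfolding eps_normals_iff
  proof (intro conjI allI impI)
    show "\<omega> \<in> \<Omega>" using \<omega> by simp
    fix \<kappa> :: real assume "\<kappa> > 0"
    have "blinfun_apply xs (u - \<omega>) \<le> (\<epsilon> + 2 * \<eta> + \<kappa>) * norm (u - \<omega>)"
      if "u \<in> \<Omega>" "dist u \<omega> < \<delta> / 4" for u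
    proof -
      have "u \<in> ?S" using that near dist_triangle[of \<omega>0 u \<omega>] by (auto simp: dist_commute)
      then have "f \<omega> \<le> f u + \<eta> * norm (u - \<omega>)"
        using \<omega>(3)[of u] by (simp add: dist_norm norm_minus_commute)
      moreover have "blinfun_apply xs (u - \<omega>) = blinfun_apply xs (u - \<omega>0) - blinfun_apply xs (\<omega> - \<omega>0)"
        by (simp add: blinfun.diff_right)
      moreover have "(\<epsilon> + \<eta>) * norm (u - \<omega>0) \<le> (\<epsilon> + \<eta>) * (norm (u - \<omega>) + norm (\<omega> - \<omega>0))"
        using norm_triangle_ineq[of "u - \<omega>" "\<omega> - \<omega>0"] \<open>\<epsilon> \<ge> 0\<close> \<eta> by (intro mult_left_mono) auto
      moreover have "0 \<le> \<kappa> * norm (u - \<omega>)" using \<open>\<kappa> > 0\<close> by simp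
      ultimately show ?thesis unfolding f_def by (simp add: algebra_simps)
    qed
    then show "\<exists>\<delta>>0. \<forall>u\<in>\<Omega>. dist u \<omega> < \<delta> \<longrightarrow>
        blinfun_apply xs (u - \<omega>) \<le> (\<epsilon> + 2 * \<eta> + \<kappa>) * norm (u - \<omega>)"
      using \<open>\<delta> > 0\<close> by (intro exI[of _ "\<delta> / 4"]) auto
  qed
  have "dist \<omega> x \<le> dist \<omega>0 \<omega> + norm (s *\<^sub>R v)"
    using dist_triangle[of \<omega> x \<omega>0] by (simp add: \<omega>0_def dist_norm norm_minus_commute)
  also have "norm (s *\<^sub>R v) \<le> (r + \<eta>) * M"
    using s \<gamma> M[of v] r \<eta> by (auto intro!: mult_mono)
  finally show ?thesis using that[OF normal] near r by simp
qed

text \<open>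
  Going from \<open>x\<close> against \<open>v\<close> increases the minimal time at rate at most \<open>1\<close>, whereas the subgradient
  inequality predicts an increase at rate at least \<open>- xs v - \<epsilon> * norm v\<close> up to a small error.  Only
  boundedness of the error matters below, as the estimate gets multiplied by a sequence tending to
  \<open>0\<close>; it is taken to be \<open>norm v\<close>.
\<close>

lemma minimal_time_subgradient_lower_bound:
  assumes "convex F" "v \<in> F"
    and sub: "xs \<in> eps_subdifferential \<epsilon> (minimal_time F \<Omega>) x"
  shows "- 1 - (\<epsilon> + 1) * norm v \<le> blinfun_apply xs v"
proof -
  obtain r \<delta> where r: "minimal_time F \<Omega> x = ereal r" and "\<delta> > 0"
    and d: "\<And>u. dist u x < \<delta> \<Longrightarrow>
      ereal (r + blinfun_apply xs (u - x) - (\<epsilon> + 1) * norm (u - x)) \<le> minimal_time F \<Omega> u"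
    by (rule minimal_time_subgradientD[OF sub zero_less_one]) blast
  define s where "s = \<delta> / (norm v + 1)"
  have np: "norm v + 1 > 0" by (simp add: add_nonneg_pos)
  then have s: "s > 0" using \<open>\<delta> > 0\<close> by (simp add: s_def)
  have "s * norm v < s * (norm v + 1)" using s by simp
  then have "s * norm v < \<delta>" using np by (simp add: s_def)
  then have "ereal (r + blinfun_apply xs (- (s *\<^sub>R v)) - (\<epsilon> + 1) * norm (- (s *\<^sub>R v)))
      \<le> minimal_time F \<Omega> (x - s *\<^sub>R v)"
    using d[of "x - s *\<^sub>R v"] s by (simp add: dist_norm)
  also have "\<dots> \<le> ereal (r + s)" using minimal_time_diff_le[OF assms(1,2), of s \<Omega> x] s r by simp
  finally have "s * (- 1 - (\<epsilon> + 1) * norm v) \<le> s * blinfun_apply xs v"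
    using s by (simp add: blinfun.minus_right blinfun.scaleR_right algebra_simps)
  then show ?thesis using s by simp
qed

text \<open>
  The scaling factors \<open>lam k\<close> serve both estimates: they keep the errors \<open>\<epsilon> k\<close> of the normals small,
  and they remove the constant \<open>-1\<close> from the lower bound on \<open>F\<close> in the limit.
\<close>

lemma singular_subdifferential_minimal_time_subset:
  fixes \<Omega> F :: "'a::banach set"
  assumes "closed \<Omega>" "F \<noteq> {}" "bounded F" "convex F" "xbar \<in> \<Omega>"
  shows "singular_subdifferential (minimal_time F \<Omega>) xbar
    \<subseteq> limiting_normal_cone \<Omega> xbar \<inter> positive_dual_cone F"
proof
  fix xs assume xs: "xs \<in> singular_subdifferential (minimal_time F \<Omega>) xbar"
  have T0: "minimal_time F \<Omega> xbar = 0" using assms by (intro minimal_time_eq_0)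
  obtain \<epsilon> lam x x' where e: "\<And>k. \<epsilon> k \<ge> 0" "\<epsilon> \<longlonglongrightarrow> 0"
    and l: "\<And>k::nat. lam k > (0::real)" "lam \<longlonglongrightarrow> 0"
    and x: "x \<longlonglongrightarrow> xbar" "(\<lambda>k. minimal_time F \<Omega> (x k)) \<longlonglongrightarrow> 0"
    and sub: "\<And>k. x' k \<in> eps_subdifferential (\<epsilon> k) (minimal_time F \<Omega>) (x k)"
    and w: "weak_star_tendsto (\<lambda>k. lam k *\<^sub>R x' k) xs"
    using xs unfolding singular_subdifferential_def T0 by auto
  obtain M where M: "\<And>v. v \<in> F \<Longrightarrow> norm v \<le> M" using assms(3) bounded_iff by blast
  define \<eta> where "\<eta> k = inverse (real (Suc k))" for k
  have \<eta>: "\<eta> k > 0" "\<eta> \<longlonglongrightarrow> 0" for k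
    using LIMSEQ_inverse_real_of_nat by (auto simp: \<eta>_def[abs_def])
  have "\<exists>\<omega>. x' k \<in> eps_normals (\<epsilon> k + 2 * \<eta> k) \<Omega> \<omega> \<and>
      dist \<omega> (x k) \<le> (real_of_ereal (minimal_time F \<Omega> (x k)) + \<eta> k) * M + \<eta> k" for k
    using minimal_time_subgradient_eps_normal[OF assms(1) M sub e(1) \<eta>(1)] by blast
  then obtain \<omega> where \<omega>: "\<And>k. x' k \<in> eps_normals (\<epsilon> k + 2 * \<eta> k) \<Omega> (\<omega> k)"
    "\<And>k. dist (\<omega> k) (x k) \<le> (real_of_ereal (minimal_time F \<Omega> (x k)) + \<eta> k) * M + \<eta> k"
    by metis
  have "(\<lambda>k. real_of_ereal (minimal_time F \<Omega> (x k))) \<longlonglongrightarrow> 0"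
    using lim_real_of_ereal[of "\<lambda>k. minimal_time F \<Omega> (x k)" 0] x(2) unfolding zero_ereal_def by blast
  from tendsto_add[OF tendsto_mult[OF tendsto_add[OF this \<eta>(2)] tendsto_const] \<eta>(2)]
  have "(\<lambda>k. (real_of_ereal (minimal_time F \<Omega> (x k)) + \<eta> k) * M + \<eta> k) \<longlonglongrightarrow> 0" by simp
  then have "(\<lambda>k. \<omega> k - x k) \<longlonglongrightarrow> 0"
    by (rule Lim_null_comparison[rotated]) (use \<omega>(2) in \<open>simp add: dist_norm\<close>)
  then have \<omega>lim: "\<omega> \<longlonglongrightarrow> xbar" by (rule Lim_transform[OF x(1)])
  have "xs \<in> limiting_normal_cone \<Omega> xbar"
    unfolding limiting_normal_cone_def mem_Collect_eq
  proof (intro exI[of _ "\<lambda>k. lam k * (\<epsilon> k + 2 * \<eta> k)"] exI[of _ \<omega>]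
      exI[of _ "\<lambda>k. lam k *\<^sub>R x' k"] conjI allI)
    show "0 \<le> lam k * (\<epsilon> k + 2 * \<eta> k)" for k
      using l(1)[of k] e(1)[of k] \<eta>(1)[of k] by (simp add: less_imp_le)
    have "(\<lambda>k. lam k * (\<epsilon> k + 2 * \<eta> k)) \<longlonglongrightarrow> 0 * (0 + 2 * 0)"
      by (intro tendsto_intros l e \<eta>)
    then show "(\<lambda>k. lam k * (\<epsilon> k + 2 * \<eta> k)) \<longlonglongrightarrow> 0" by simp
    show "lam k *\<^sub>R x' k \<in> eps_normals (lam k * (\<epsilon> k + 2 * \<eta> k)) \<Omega> (\<omega> k)" for k
      using \<omega>(1) l(1) by (rule eps_normals_scaleR)
  qed (use \<omega>lim w in auto)
  moreover have "xs \<in> positive_dual_cone F"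
    unfolding positive_dual_cone_def mem_Collect_eq
  proof
    fix v assume v: "v \<in> F"
    have "(\<lambda>k. lam k * (- 1 - (\<epsilon> k + 1) * norm v)) \<longlonglongrightarrow> 0 * (- 1 - (0 + 1) * norm v)"
      by (intro tendsto_intros l e)
    moreover have "(\<lambda>k. blinfun_apply (lam k *\<^sub>R x' k) v) \<longlonglongrightarrow> blinfun_apply xs v"
      using w unfolding weak_star_tendsto_iff by (rule spec)
    moreover have "lam k * (- 1 - (\<epsilon> k + 1) * norm v) \<le> blinfun_apply (lam k *\<^sub>R x' k) v" for k
      using mult_left_mono[OF minimal_time_subgradient_lower_bound[OF assms(4) v sub[of k]], of "lam k"]
        l(1)[of k] by (simp add: scaleR_blinfun.rep_eq)
    ultimately have "0 * (- 1 - (0 + 1) * norm v) \<le> blinfun_apply xs v"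
      by (intro LIMSEQ_le) blast+
    then show "0 \<le> blinfun_apply xs v" by simp
  qed
  ultimately show "xs \<in> limiting_normal_cone \<Omega> xbar \<inter> positive_dual_cone F" by simp
qed

section \<open>Normals that are small on the dynamics are subgradients\<close>

text \<open>
  If \<open>u\<close> reaches \<open>\<omega> = u + t *\<^sub>R v \<in> \<Omega>\<close> in time \<open>t\<close>, then
  \<open>xs (u - x) = xs (\<omega> - x) + t * (- xs v)\<close>, where the normal inequality bounds the first summand by
  about \<open>\<epsilon> * (norm (u - x) + t * M)\<close> and the second one is at most \<open>t * \<rho>\<close>.  Since \<open>\<epsilon> * M + \<rho> < 1\<close>, the
  total is at most \<open>t\<close> plus an error of order \<open>\<epsilon> * norm (u - x)\<close>.  For long times \<open>t\<close> the point \<open>\<omega>\<close> may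
  be too far from \<open>x\<close> for the normal inequality to apply, but then \<open>t\<close> alone exceeds \<open>xs (u - x)\<close>.
\<close>

lemma eps_normal_minimal_time_subgradient:
  assumes "F \<noteq> {}" and M: "\<And>v. v \<in> F \<Longrightarrow> norm v \<le> M"
    and N: "xs \<in> eps_normals \<epsilon> \<Omega> x" and "\<epsilon> \<ge> 0"
    and \<rho>: "\<And>v. v \<in> F \<Longrightarrow> - blinfun_apply xs v \<le> \<rho>" and small: "\<epsilon> * M + \<rho> < 1"
  shows "xs \<in> eps_subdifferential \<epsilon> (minimal_time F \<Omega>) x"
proof -
  have "x \<in> \<Omega>" using N by (simp add: eps_normals_iff)
  then have T0: "minimal_time F \<Omega> x = ereal 0"
    using minimal_time_eq_0[OF assms(1)] by (simp add: zero_ereal_def)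
  have fin: "minimal_time F \<Omega> u \<noteq> -\<infinity>" for u using minimal_time_nonneg[of F \<Omega> u] by auto
  have M0: "M \<ge> 0" using assms(1) M norm_ge_zero order_trans by blast
  show ?thesis
    unfolding eps_subdifferential_iff[of "minimal_time F \<Omega>", OF T0 fin]
  proof (intro allI impI)
    fix \<eta> :: real assume \<eta>: "\<eta> > 0"
    \<comment> \<open>The slack \<open>\<kappa>\<close> uses up at most what is left of \<open>\<epsilon> * M + \<rho> < 1\<close>.\<close>
    define \<kappa> where "\<kappa> = min \<eta> ((1 - \<epsilon> * M - \<rho>) / (M + 1))"
    have \<kappa>: "\<kappa> > 0" "\<kappa> \<le> \<eta>" using \<eta> small M0 by (auto simp: \<kappa>_def)
    have "\<kappa> * M \<le> \<kappa> * (M + 1)" using \<kappa> by simp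
    also have "\<dots> \<le> (1 - \<epsilon> * M - \<rho>) / (M + 1) * (M + 1)"
      using M0 by (intro mult_right_mono) (auto simp: \<kappa>_def)
    also have "\<dots> = 1 - \<epsilon> * M - \<rho>" using M0 by simp
    finally have \<kappa>M: "(\<epsilon> + \<kappa>) * M + \<rho> \<le> 1" by (simp add: algebra_simps)
    obtain \<delta> where "\<delta> > 0" and d: "\<And>\<omega>. \<omega> \<in> \<Omega> \<Longrightarrow> dist \<omega> x < \<delta> \<Longrightarrow>
        blinfun_apply xs (\<omega> - x) \<le> (\<epsilon> + \<kappa>) * norm (\<omega> - x)"
      using N \<kappa> by (auto simp: eps_normals_iff)
    \<comment> \<open>Times up to \<open>b\<close> move a point by less than \<open>\<delta> / 2\<close>; the radius \<open>\<beta>\<close> leaves the other half of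
        \<open>\<delta>\<close> and forces \<open>xs (u - x) \<le> b\<close>, which excludes longer times.\<close>
    define b where "b = \<delta> / (2 * (M + 1))"
    have b: "b > 0" "b * M < \<delta> / 2" using \<open>\<delta> > 0\<close> M0 by (auto simp: b_def field_simps)
    define \<beta> where "\<beta> = min (\<delta> / 2) (b / (norm xs + 1))"
    have np: "norm xs + 1 > 0" by (simp add: add_nonneg_pos)
    have \<beta>: "\<beta> > 0" "\<beta> \<le> \<delta> / 2" "\<beta> \<le> b / (norm xs + 1)"
      using \<open>\<delta> > 0\<close> b(1) np unfolding \<beta>_def min_less_iff_conj
      by (intro conjI divide_pos_pos min.cobounded1 min.cobounded2; simp)+
    have "ereal (0 + blinfun_apply xs (u - x) - (\<epsilon> + \<eta>) * norm (u - x)) \<le> minimal_time F \<Omega> u"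
      if u: "dist u x < \<beta>" for u
    proof (rule ccontr)
      assume "\<not> ?thesis"
      then have "minimal_time F \<Omega> u < ereal (blinfun_apply xs (u - x) - (\<epsilon> + \<eta>) * norm (u - x))"
        by simp
      then obtain t v where t: "t \<ge> 0" "v \<in> F" "u + t *\<^sub>R v \<in> \<Omega>"
        and lt: "t < blinfun_apply xs (u - x) - (\<epsilon> + \<eta>) * norm (u - x)"
        by (rule minimal_time_lessE)
      have "0 \<le> (\<epsilon> + \<eta>) * norm (u - x)" using \<open>\<epsilon> \<ge> 0\<close> \<eta> by simp
      then have "t \<le> blinfun_apply xs (u - x)" using lt by linarith
      also have "\<dots> \<le> norm xs * norm (u - x)" using norm_blinfun[of xs "u - x"] by simp
      also have "\<dots> \<le> (norm xs + 1) * \<beta>" using u by (intro mult_mono) (auto simp: dist_norm)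
      also have "\<dots> \<le> b" using \<beta>(3) np by (simp add: field_simps)
      finally have "t \<le> b" .
      have tv: "norm (t *\<^sub>R v) \<le> t * M" using t M by (simp add: mult_left_mono)
      have tri: "norm (u + t *\<^sub>R v - x) \<le> norm (u - x) + t * M"
        using norm_triangle_ineq[of "u - x" "t *\<^sub>R v"] tv by (simp add: algebra_simps)
      moreover have "t * M \<le> b * M" using \<open>t \<le> b\<close> M0 by (rule mult_right_mono)
      ultimately have "dist (u + t *\<^sub>R v) x < \<delta>"
        using u \<beta>(2) b(2) unfolding dist_norm by linarith
      then have "blinfun_apply xs (u + t *\<^sub>R v - x) \<le> (\<epsilon> + \<kappa>) * norm (u + t *\<^sub>R v - x)"
        using d t by blast
      also have "\<dots> \<le> (\<epsilon> + \<kappa>) * (norm (u - x) + t * M)"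
        using tri \<open>\<epsilon> \<ge> 0\<close> \<kappa> by (intro mult_left_mono) auto
      finally have "blinfun_apply xs (u - x) + t * blinfun_apply xs v
          \<le> (\<epsilon> + \<kappa>) * norm (u - x) + t * ((\<epsilon> + \<kappa>) * M)"
        by (simp add: blinfun.diff_right blinfun.add_right blinfun.scaleR_right algebra_simps)
      moreover have "t * (- blinfun_apply xs v) \<le> t * \<rho>" using \<rho> t by (intro mult_left_mono) auto
      moreover have "t * ((\<epsilon> + \<kappa>) * M + \<rho>) \<le> t" using mult_left_mono[OF \<kappa>M t(1)] by simp
      moreover have "(\<epsilon> + \<kappa>) * norm (u - x) \<le> (\<epsilon> + \<eta>) * norm (u - x)"
        using \<kappa> by (intro mult_right_mono) auto
      ultimately show False using lt by (simp add: distrib_left)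
    qed
    with \<beta>(1) show "\<exists>\<delta>>0. \<forall>u. dist u x < \<delta> \<longrightarrow>
        ereal (0 + blinfun_apply xs (u - x) - (\<epsilon> + \<eta>) * norm (u - x)) \<le> minimal_time F \<Omega> u" by blast
  qed
qed

text \<open>
  On the cone in question \<open>\<sigma>\<^sub>F (- xs) = 0\<close>, because \<open>0 \<in> F\<close>; continuity thus makes the values
  \<open>\<sigma>\<^sub>F (- x' k)\<close> tend to \<open>0\<close> for the approximating normals \<open>x' k\<close>.  Dividing by a \<open>lam k\<close> that tends to
  \<open>0\<close> more slowly than these values and than \<open>\<epsilon> k\<close> yields normals to which the previous lemma applies.
\<close>

lemma subset_singular_subdifferential_minimal_time:
  assumes "bounded F" "0 \<in> F" "xbar \<in> \<Omega>"
    and cont: "seq_weak_star_continuous_on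
          (uminus ` (limiting_normal_cone \<Omega> xbar \<inter> positive_dual_cone F)) (support_function F)"
  shows "limiting_normal_cone \<Omega> xbar \<inter> positive_dual_cone F
    \<subseteq> singular_subdifferential (minimal_time F \<Omega>) xbar"
proof
  fix xs assume xs: "xs \<in> limiting_normal_cone \<Omega> xbar \<inter> positive_dual_cone F"
  have F: "F \<noteq> {}" using assms by auto
  have T0: "minimal_time F \<Omega> y = 0" if "y \<in> \<Omega>" for y using F that by (rule minimal_time_eq_0)
  obtain \<epsilon> x x' where e: "\<And>k::nat. \<epsilon> k \<ge> (0::real)" "\<epsilon> \<longlonglongrightarrow> 0" and x: "x \<longlonglongrightarrow> xbar"
    and w: "weak_star_tendsto x' xs" and N: "\<And>k. x' k \<in> eps_normals (\<epsilon> k) \<Omega> (x k)"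
    using xs unfolding limiting_normal_cone_def by auto
  obtain M where M: "\<And>v. v \<in> F \<Longrightarrow> norm v \<le> M" using assms(1) bounded_iff by blast
  have "support_function F (- xs) = 0"
    unfolding support_function_def
  proof (rule antisym)
    show "(SUP v\<in>F. ereal (blinfun_apply (- xs) v)) \<le> 0"
      using xs by (auto simp: positive_dual_cone_def uminus_blinfun.rep_eq intro!: SUP_least)
    show "0 \<le> (SUP v\<in>F. ereal (blinfun_apply (- xs) v))"
      using SUP_upper[OF assms(2), of "\<lambda>v. ereal (blinfun_apply (- xs) v)"] by (simp add: zero_ereal_def)
  qed
  moreover have "weak_star_tendsto (\<lambda>k. - x' k) (- xs)"
    using w by (auto simp: weak_star_tendsto_iff uminus_blinfun.rep_eq intro: tendsto_minus)
  ultimately have supp0: "(\<lambda>k. support_function F (- x' k)) \<longlonglongrightarrow> 0"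
    using cont xs unfolding seq_weak_star_continuous_on_def by (metis imageI)
  define \<sigma> where "\<sigma> k = real_of_ereal (support_function F (- x' k))" for k
  have \<sigma>: "- blinfun_apply (x' k) v \<le> \<sigma> k" if "v \<in> F" for k v
  proof -
    have up: "ereal (- blinfun_apply (x' k) v) \<le> support_function F (- x' k)"
      using SUP_upper[OF that, of "\<lambda>v. ereal (blinfun_apply (- x' k) v)"]
      by (simp add: support_function_def uminus_blinfun.rep_eq)
    have "support_function F (- x' k) \<le> ereal (norm (x' k) * M)"
      unfolding support_function_def
    proof (rule SUP_least)
      fix v assume "v \<in> F"
      then have "norm (x' k) * norm v \<le> norm (x' k) * M" using M by (intro mult_left_mono) auto
      then show "ereal (blinfun_apply (- x' k) v) \<le> ereal (norm (x' k) * M)"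
        using norm_blinfun[of "x' k" v] by (simp add: uminus_blinfun.rep_eq)
    qed
    then show ?thesis using up by (cases "support_function F (- x' k)") (auto simp: \<sigma>_def)
  qed
  have \<sigma>0: "\<sigma> k \<ge> 0" for k using \<sigma>[OF assms(2), of k] by simp
  have \<sigma>lim: "\<sigma> \<longlonglongrightarrow> 0"
    using lim_real_of_ereal[of "\<lambda>k. support_function F (- x' k)" 0] supp0
    unfolding zero_ereal_def \<sigma>_def by blast
  \<comment> \<open>The square root makes \<open>\<epsilon> k / lam k\<close> and \<open>\<sigma> k / lam k\<close> at most \<open>lam k\<close>; the summand
      \<open>inverse (Suc k)\<close> keeps \<open>lam k\<close> positive.\<close>
  define lam where "lam k = sqrt (\<epsilon> k + \<sigma> k + inverse (real (Suc k)))" for k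
  have pos: "0 < \<epsilon> k + \<sigma> k + inverse (real (Suc k))" for k
    using e(1)[of k] \<sigma>0[of k] by (simp add: add_nonneg_pos)
  have l0: "lam k > 0" for k using pos by (simp add: lam_def)
  have "(\<lambda>k. sqrt (\<epsilon> k + \<sigma> k + inverse (real (Suc k)))) \<longlonglongrightarrow> sqrt (0 + 0 + 0)"
    by (intro tendsto_intros e \<sigma>lim LIMSEQ_inverse_real_of_nat)
  then have llim: "lam \<longlonglongrightarrow> 0" by (simp add: lam_def[abs_def])
  have lsq: "lam k * lam k = \<epsilon> k + \<sigma> k + inverse (real (Suc k))" for k
    using pos[of k] by (simp add: lam_def)
  have quot: "\<epsilon> k / lam k \<le> lam k" "\<sigma> k / lam k \<le> lam k" for k
    using e(1)[of k] \<sigma>0[of k] l0[of k] lsq[of k] by (simp_all add: divide_le_eq)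
  have elim: "(\<lambda>k. \<epsilon> k / lam k) \<longlonglongrightarrow> 0"
    using quot e(1) l0 by (intro tendsto_sandwich[OF _ _ tendsto_const llim]) (auto simp: less_imp_le)
  have "(\<lambda>k. \<sigma> k / lam k) \<longlonglongrightarrow> 0"
    using quot \<sigma>0 l0 by (intro tendsto_sandwich[OF _ _ tendsto_const llim]) (auto simp: less_imp_le)
  then have "(\<lambda>k. \<epsilon> k / lam k * M + \<sigma> k / lam k) \<longlonglongrightarrow> 0 * M + 0"
    by (intro tendsto_intros elim)
  then have "eventually (\<lambda>k. \<epsilon> k / lam k * M + \<sigma> k / lam k < 1) sequentially"
    by (intro order_tendstoD) auto
  then obtain K where K: "\<And>k. k \<ge> K \<Longrightarrow> \<epsilon> k / lam k * M + \<sigma> k / lam k < 1"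
    by (auto simp: eventually_sequentially)
  have sub: "inverse (lam k) *\<^sub>R x' k \<in> eps_subdifferential (\<epsilon> k / lam k) (minimal_time F \<Omega>) (x k)"
    if "k \<ge> K" for k
  proof (rule eps_normal_minimal_time_subgradient[OF F M _ _ _ K[OF that]])
    show "inverse (lam k) *\<^sub>R x' k \<in> eps_normals (\<epsilon> k / lam k) \<Omega> (x k)"
      using eps_normals_scaleR[OF N, of "inverse (lam k)" k] l0[of k] by (simp add: divide_inverse mult.commute)
    show "0 \<le> \<epsilon> k / lam k" using e(1)[of k] l0[of k] by simp
    show "- blinfun_apply (inverse (lam k) *\<^sub>R x' k) v \<le> \<sigma> k / lam k" if "v \<in> F" for v
      using divide_right_mono[OF \<sigma>[OF that, of k], of "lam k"] l0[of k]
      by (simp add: scaleR_blinfun.rep_eq divide_inverse mult.commute)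
  qed
  show "xs \<in> singular_subdifferential (minimal_time F \<Omega>) xbar"
    unfolding singular_subdifferential_def T0[OF assms(3)]
  proof (simp, intro exI conjI)
    \<comment> \<open>The bound needed for the subgradients holds only from \<open>K\<close> on, hence the shift.\<close>
    show "\<forall>k. 0 \<le> \<epsilon> (k + K) / lam (k + K)" using e(1) l0 by (simp add: less_imp_le)
    show "(\<lambda>k. \<epsilon> (k + K) / lam (k + K)) \<longlonglongrightarrow> 0" using elim by (rule LIMSEQ_ignore_initial_segment)
    show "\<forall>k. 0 < lam (k + K)" using l0 by simp
    show "(\<lambda>k. lam (k + K)) \<longlonglongrightarrow> 0" using llim by (rule LIMSEQ_ignore_initial_segment)
    show "(\<lambda>k. x (k + K)) \<longlonglongrightarrow> xbar" using x by (rule LIMSEQ_ignore_initial_segment)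
    show "(\<lambda>k. minimal_time F \<Omega> (x (k + K))) \<longlonglongrightarrow> 0"
      using T0 N by (simp add: eps_normals_iff)
    show "\<forall>k. inverse (lam (k + K)) *\<^sub>R x' (k + K)
        \<in> eps_subdifferential (\<epsilon> (k + K) / lam (k + K)) (minimal_time F \<Omega>) (x (k + K))"
      using sub by simp
    have "lam k *\<^sub>R inverse (lam k) *\<^sub>R x' k = x' k" for k using l0[of k] by simp
    then show "weak_star_tendsto (\<lambda>k. lam (k + K) *\<^sub>R inverse (lam (k + K)) *\<^sub>R x' (k + K)) xs"
      using w unfolding weak_star_tendsto_iff by (auto intro: LIMSEQ_ignore_initial_segment)
  qed
qed

theorem theorem5p3:
  fixes \<Omega> F :: "'a::banach set" and xbar :: 'a
  assumes "\<Omega> \<noteq> {}" and "closed \<Omega>"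
    and "F \<noteq> {}" and "closed F" and "bounded F" and "convex F"
    and "xbar \<in> \<Omega>"
  shows "singular_subdifferential (minimal_time F \<Omega>) xbar
           \<subseteq> limiting_normal_cone \<Omega> xbar \<inter> positive_dual_cone F
    \<and> (0 \<in> F \<and>
        seq_weak_star_continuous_on
          (uminus ` (limiting_normal_cone \<Omega> xbar \<inter> positive_dual_cone F))
          (support_function F)
        \<longrightarrow> singular_subdifferential (minimal_time F \<Omega>) xbar
              = limiting_normal_cone \<Omega> xbar \<inter> positive_dual_cone F)"
  using singular_subdifferential_minimal_time_subset[OF assms(2,3,5,6,7)]
    subset_singular_subdifferential_minimal_time[OF assms(5) _ assms(7)]
  by blast

end
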